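(* Let $f : \mathbb{R}_+ \to \mathbb{R}$ be an arbitrary function with $J(f) \neq \emptyset$. Let $\{D_n : n \in \mathbb{N}\}$ be an arbitrary partition of $J(f)$. Let $\Phi : \mathbb{R}_+ \to \mathbb{R}_+$ be strictly increasing and continuous with $\Phi(0) = 0$. Let $B$ be a non-empty subset of $L(f)$. Then (as an identity in $[0,\infty]$) $$\sum_{s \in B} \Phi(|\Delta f(s)|) = \mu_{\Phi \circ |\Delta f|}(B \cap J(f)) = \sum_{n=1}^{\infty} \sum_{s \in D_n} \Phi(|\Delta f(s)|)\, 1_B(s) = \sum_{n=1}^{\infty} \Phi(|\Delta f(\varphi(n))|),$$ where the last equality holds for all bijective mappings $\varphi : \mathbb{N} \to B \cap J(f)$. If in addition $f$ is regulated, then $$\sum_{0 < s \leq t} \Phi(|\Delta f(s)|) = \mu_{\Phi \circ |\Delta f|}((0,t] \cap J(f)) = \sum_{n=1}^{\infty} \sum_{s \in D_n} \Phi(|\Delta f(s)|)\, 1_{(0,t]}(s) = \sum_{n=1}^{\infty} \Phi(|\Delta f(\varphi(n))|)$$ for all $t \in (0,\infty)$, where the last equality holds for all bijective mappings $\varphi : \mathbb{N} \to (0,t] \cap J(f)$.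
   Context: $\mathbb{R}_+ = [0,\infty)$ and $\mathbb{N} = \{1,2,3,\dots\}$. For $f : \mathbb{R}_+ \to \mathbb{R}$, $f(t+)$ and $f(t-)$ denote the finite right-hand and left-hand limits of $f$ at $t$ (taken over $s>t$, respectively $s<t$), when they exist in $\mathbb{R}$. $L(f)$ is the set of all $t \in (0,\infty)$ such that both $f(t+)$ and $f(t-)$ exist in $\mathbb{R}$; $\Delta f(t) := f(t+) - f(t-)$ for $t \in L(f)$; and $J(f) := \{t \in L(f) : \Delta f(t) \neq 0\}$. $f$ is regulated on $\mathbb{R}_+$ if $f(t-)$ and $f(t+)$ exist in $\mathbb{R}$ for every $t > 0$ and $f(0+)$ exists in $\mathbb{R}$; in that case $L(f) = (0,\infty)$. A partition $\{D_n : n \in \mathbb{N}\}$ of a set $D$ means a sequence of pairwise disjoint (possibly empty) sets with union $D$. Unordered sums: for a non-empty set $L$, a function $h : L \to \mathbb{R}_+$ and a non-empty $A \subseteq L$, $\sum_{s \in A} h(s) := \sup\{\sum_{s \in F} h(s) : F \subseteq A \text{ finite}\} \in [0,\infty]$, and $\sum_{s \in \emptyset} h(s) := 0$. For $A \subseteq L$, $\mu_h(A) := \sum_{s \in A} h(s)$. Here $\mu_{\Phi\circ|\Delta f|}$ is taken with $L = L(f)$ and $h(s) = \Phi(|\Delta f(s)|)$. The sum $\sum_{0<s\le t}$ is the unordered sum over $s \in (0,t]$. $1_B$ denotes the indicator function of $B$. *)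

theory Defs
  imports "HOL-Analysis.Analysis"
begin

text \<open>
  A function on \<open>[0,\<infinity>)\<close> is represented by a total function on the reals. Only its values on
  \<open>[0,\<infinity>)\<close> matter below: left limits are taken at points \<open>t > 0\<close> only, and for
  such \<open>t\<close> the set \<open>{0<..<t}\<close> belongs to the filter \<open>at_left t\<close>.
\<close>

definition has_right_limit :: "(real \<Rightarrow> real) \<Rightarrow> real \<Rightarrow> bool" where
  "has_right_limit f t \<longleftrightarrow> (\<exists>l. (f \<longlongrightarrow> l) (at_right t))"

definition has_left_limit :: "(real \<Rightarrow> real) \<Rightarrow> real \<Rightarrow> bool" where
  "has_left_limit f t \<longleftrightarrow> (\<exists>l. (f \<longlongrightarrow> l) (at_left t))"

definition two_sided_limit_points :: "(real \<Rightarrow> real) \<Rightarrow> real set" where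
  "two_sided_limit_points f = {t. 0 < t \<and> has_right_limit f t \<and> has_left_limit f t}"

text \<open>Meaningful only for \<open>t \<in> two_sided_limit_points f\<close>.\<close>

definition jump :: "(real \<Rightarrow> real) \<Rightarrow> real \<Rightarrow> real" where
  "jump f t = Lim (at_right t) f - Lim (at_left t) f"

definition jump_points :: "(real \<Rightarrow> real) \<Rightarrow> real set" where
  "jump_points f = {t \<in> two_sided_limit_points f. jump f t \<noteq> 0}"

definition regulated :: "(real \<Rightarrow> real) \<Rightarrow> bool" where
  "regulated f \<longleftrightarrow> (\<forall>t>0. has_left_limit f t \<and> has_right_limit f t) \<and> has_right_limit f 0"

text \<open>
  The index set is \<open>{1, 2, 3, \<dots>}\<close>, so the value \<open>D 0\<close> is irrelevant. The sets may be empty.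
\<close>

definition partition_seq :: "(nat \<Rightarrow> 'a set) \<Rightarrow> 'a set \<Rightarrow> bool" where
  "partition_seq D S \<longleftrightarrow> disjoint_family_on D {1..} \<and> (\<Union>n\<in>{1..}. D n) = S"

text \<open>
  Intended for \<open>h \<ge> 0\<close> on \<open>A\<close>. For \<open>A = {}\<close> the only \<open>F\<close> is \<open>{}\<close> and the value is \<open>0\<close>.
\<close>

definition unordered_sum :: "('a \<Rightarrow> real) \<Rightarrow> 'a set \<Rightarrow> ennreal" where
  "unordered_sum h A = (SUP F \<in> {F. finite F \<and> F \<subseteq> A}. ennreal (\<Sum>s\<in>F. h s))"

definition mu :: "('a \<Rightarrow> real) \<Rightarrow> 'a set \<Rightarrow> ennreal" where
  "mu h A = unordered_sum h A"

text \<open>The series over \<open>n = 1, 2, 3, \<dots>\<close>; the term at index \<open>0\<close> does not enter.\<close>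

definition series_from_1 :: "(nat \<Rightarrow> ennreal) \<Rightarrow> ennreal" where
  "series_from_1 a = (\<Sum>n. a (Suc n))"

end

theory Submission
  imports Defs
begin

text \<open>
  An unordered sum of a non-negative function \<open>h\<close> is a countably additive function of its index
  set: the finite subsets of a disjoint union are directed by inclusion, so the supremum over them
  may be interchanged with the sum over the pieces (\<open>unordered_sum_UN\<close>). All the
  series in the theorem are instances of this one fact, for different decompositions of the same
  set \<open>C \<inter> jump_points f\<close>. The partition \<open>D\<close> decomposes it into the sets \<open>D n \<inter> C\<close>, where the
  intersection is expressed by the indicator function (\<open>unordered_sum_mult_indicator\<close>). An
  enumeration \<open>\<phi>\<close> decomposes it into the singletons \<open>{\<phi> n}\<close>, so the order of enumeration is
  immaterial (\<open>unordered_sum_bij_betw\<close>).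

  The passage from \<open>C\<close> to \<open>C \<inter> jump_points f\<close> rests on \<open>\<Phi> 0 = 0\<close>: at a point of
  \<open>two_sided_limit_points f\<close> that is not a jump point, the jump is zero and so is the summand. The
  second half of the theorem is the case \<open>C = {0<..t}\<close> of the first, since a regulated function has
  both one-sided limits at every positive point.
\<close>

text \<open>
  Every finite subset of \<open>A\<close> is the trace on \<open>A\<close> of a finite subset of \<open>U\<close>. Sums over different
  subsets of \<open>U\<close> thereby become suprema over one common directed family, and can be compared or
  added for each member of the family.
\<close>

lemma unordered_sum_eq_SUP_Int:
  assumes "A \<subseteq> U"
  shows "unordered_sum h A = (SUP F\<in>{F. finite F \<and> F \<subseteq> U}. ennreal (\<Sum>s\<in>F \<inter> A. h s))"
proof -
  have "{F. finite F \<and> F \<subseteq> A} = (\<lambda>F. F \<inter> A) ` {F. finite F \<and> F \<subseteq> U}"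
    using assms by (auto simp: image_iff)
  then show ?thesis
    unfolding unordered_sum_def by (simp add: image_image)
qed

lemma unordered_sum_mono_neutral:
  assumes "A \<subseteq> B" "\<And>s. s \<in> B - A \<Longrightarrow> h s = 0"
  shows "unordered_sum h A = unordered_sum h B"
proof -
  have "(\<Sum>s\<in>F \<inter> A. h s) = (\<Sum>s\<in>F. h s)" if "finite F" "F \<subseteq> B" for F
    using that assms by (intro sum.mono_neutral_left) auto
  then have "(SUP F\<in>{F. finite F \<and> F \<subseteq> B}. ennreal (\<Sum>s\<in>F \<inter> A. h s)) = unordered_sum h B"
    unfolding unordered_sum_def by (intro SUP_cong) auto
  then show ?thesis
    using unordered_sum_eq_SUP_Int[OF assms(1), of h] by simp
qed

lemma unordered_sum_mult_indicator:
  "unordered_sum (\<lambda>s. h s * indicator B s) A = unordered_sum h (A \<inter> B)"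
proof -
  have "(\<Sum>s\<in>F. h s * indicator B s) = (\<Sum>s\<in>F \<inter> (A \<inter> B). h s)" if "finite F" "F \<subseteq> A" for F
  proof -
    have "F \<inter> (A \<inter> B) = F \<inter> B"
      using that by auto
    then show ?thesis
      using that by (simp add: sum.inter_restrict indicator_def if_distrib cong: if_cong)
  qed
  then have "unordered_sum (\<lambda>s. h s * indicator B s) A
      = (SUP F\<in>{F. finite F \<and> F \<subseteq> A}. ennreal (\<Sum>s\<in>F \<inter> (A \<inter> B). h s))"
    unfolding unordered_sum_def by (intro SUP_cong) auto
  then show ?thesis
    using unordered_sum_eq_SUP_Int[of "A \<inter> B" A h] by simp
qed

lemma unordered_sum_singleton:
  assumes "h a \<ge> 0"
  shows "unordered_sum h {a} = ennreal (h a)"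
proof -
  have "{F. finite F \<and> F \<subseteq> {a}} = {{}, {a}}"
    by (auto simp: subset_singleton_iff)
  then show ?thesis
    unfolding unordered_sum_def by (simp add: sup_absorb2)
qed

lemma suminf_sum_Int_disjoint_family:
  assumes h: "\<And>s. s \<in> F \<Longrightarrow> h s \<ge> 0"
    and F: "F \<subseteq> (\<Union>n. A n)" and disj: "disjoint_family A"
    and "finite F"
  shows "(\<Sum>n. ennreal (\<Sum>s\<in>F \<inter> A n. h s)) = ennreal (\<Sum>s\<in>F. h s)"
proof -
  have "ennreal (\<Sum>s\<in>F \<inter> A n. h s) = (\<Sum>s\<in>F. ennreal (h s) * indicator (A n) s)" for n
    using h \<open>finite F\<close>
    by (simp add: sum_ennreal[symmetric] sum.inter_restrict indicator_def if_distrib cong: if_cong)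
  then have "(\<Sum>n. ennreal (\<Sum>s\<in>F \<inter> A n. h s))
      = (\<Sum>s\<in>F. \<Sum>n. ennreal (h s) * indicator (A n) s)"
    by (simp add: suminf_sum)
  also have "\<dots> = (\<Sum>s\<in>F. ennreal (h s))"
  proof (intro sum.cong refl)
    fix s
    assume "s \<in> F"
    then obtain n where "s \<in> A n"
      using F by auto
    then show "(\<Sum>n. ennreal (h s) * indicator (A n) s) = ennreal (h s)"
      by (rule suminf_cmult_indicator[OF disj])
  qed
  also have "\<dots> = ennreal (\<Sum>s\<in>F. h s)"
    using h by (simp add: sum_ennreal)
  finally show ?thesis .
qed

text \<open>
  Enlarging a finite set enlarges its trace on every piece at once. The traces are thus directed
  uniformly in \<open>n\<close>, which is what allows the series and the supremum to be interchanged.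
\<close>

lemma unordered_sum_UN:
  assumes h: "\<And>s. s \<in> (\<Union>n. A n) \<Longrightarrow> h s \<ge> 0"
    and disj: "disjoint_family A"
  shows "unordered_sum h (\<Union>n. A n) = (\<Sum>n. unordered_sum h (A n))"
proof -
  let ?I = "{F. finite F \<and> F \<subseteq> (\<Union>n. A n)}"
  have mono: "ennreal (\<Sum>s\<in>F \<inter> A n. h s) \<le> ennreal (\<Sum>s\<in>G \<inter> A n. h s)"
    if "F \<subseteq> G" "finite G" for F G n
    using that h by (intro ennreal_leI sum_mono2) auto
  have "(\<Sum>n. unordered_sum h (A n)) = (\<Sum>n. SUP F\<in>?I. ennreal (\<Sum>s\<in>F \<inter> A n. h s))"
    by (intro suminf_cong unordered_sum_eq_SUP_Int) auto
  also have "\<dots> = (SUP F\<in>?I. \<Sum>n. ennreal (\<Sum>s\<in>F \<inter> A n. h s))"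
  proof (rule ennreal_suminf_SUP_eq_directed)
    fix N :: "nat set" and F G
    assume "F \<in> ?I" "G \<in> ?I"
    then show "\<exists>K\<in>?I. \<forall>n\<in>N. ennreal (\<Sum>s\<in>F \<inter> A n. h s) \<le> ennreal (\<Sum>s\<in>K \<inter> A n. h s)
        \<and> ennreal (\<Sum>s\<in>G \<inter> A n. h s) \<le> ennreal (\<Sum>s\<in>K \<inter> A n. h s)"
      by (intro bexI[of _ "F \<union> G"] ballI conjI mono) auto
  qed
  also have "\<dots> = (SUP F\<in>?I. ennreal (\<Sum>s\<in>F. h s))"
    using h by (intro SUP_cong refl suminf_sum_Int_disjoint_family disj) blast+
  finally show ?thesis
    by (simp add: unordered_sum_def)
qed

lemma unordered_sum_partition_seq:
  assumes h: "\<And>s. s \<in> S \<Longrightarrow> h s \<ge> 0" and D: "partition_seq D S"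
  shows "unordered_sum h S = series_from_1 (\<lambda>n. unordered_sum h (D n))"
proof -
  have disj: "disjoint_family (\<lambda>n. D (Suc n))"
    using D by (auto simp: partition_seq_def disjoint_family_on_def)
  have "{1..} = range Suc"
    by (auto simp: image_iff Suc_le_eq gr0_conv_Suc)
  then have S: "S = (\<Union>n. D (Suc n))"
    using D by (simp add: partition_seq_def image_image)
  show ?thesis
    using unordered_sum_UN[OF _ disj, of h] h by (simp add: series_from_1_def S)
qed

lemma unordered_sum_bij_betw:
  assumes h: "\<And>s. s \<in> S \<Longrightarrow> h s \<ge> 0" and \<phi>: "bij_betw \<phi> {1..} S"
  shows "unordered_sum h S = series_from_1 (\<lambda>n. ennreal (h (\<phi> n)))"
proof -
  have "partition_seq (\<lambda>n. {\<phi> n}) S"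
    using \<phi> by (auto simp: partition_seq_def disjoint_family_on_def bij_betw_def inj_on_def)
  then have "unordered_sum h S = series_from_1 (\<lambda>n. unordered_sum h {\<phi> n})"
    by (rule unordered_sum_partition_seq[rotated]) (rule h)
  also have "\<dots> = series_from_1 (\<lambda>n. ennreal (h (\<phi> n)))"
    unfolding series_from_1_def
    using h \<phi> by (intro suminf_cong unordered_sum_singleton) (auto simp: bij_betw_def)
  finally show ?thesis .
qed

lemma partition_seq_Int:
  "partition_seq D S \<Longrightarrow> partition_seq (\<lambda>n. D n \<inter> C) (C \<inter> S)"
  by (fastforce simp: partition_seq_def disjoint_family_on_def)

text \<open>
  The chain of identities for an arbitrary set \<open>C\<close> of points with two-sided limits; the two halves
  of the theorem are the cases \<open>C = B\<close> and \<open>C = {0<..t}\<close>.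
\<close>

lemma jump_sum_identities:
  fixes f \<Phi> :: "real \<Rightarrow> real"
  assumes D: "partition_seq D (jump_points f)"
    and \<Phi>: "\<Phi> \<in> {0..} \<rightarrow> {0..}" "\<Phi> 0 = 0"
    and C: "C \<subseteq> two_sided_limit_points f"
  defines "h \<equiv> \<lambda>s. \<Phi> \<bar>jump f s\<bar>"
  shows "unordered_sum h C = mu h (C \<inter> jump_points f)"
    and "mu h (C \<inter> jump_points f)
      = series_from_1 (\<lambda>n. unordered_sum (\<lambda>s. h s * indicator C s) (D n))"
    and "bij_betw \<phi> {1..} (C \<inter> jump_points f)
      \<Longrightarrow> mu h (C \<inter> jump_points f) = series_from_1 (\<lambda>n. ennreal (h (\<phi> n)))"
proof -
  have h: "h s \<ge> 0" for s
    using \<Phi>(1) by (auto simp: h_def Pi_iff)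
  have "h s = 0" if "s \<in> C - C \<inter> jump_points f" for s
    using that C \<Phi>(2) by (auto simp: h_def jump_points_def)
  then show "unordered_sum h C = mu h (C \<inter> jump_points f)"
    unfolding mu_def by (intro unordered_sum_mono_neutral[symmetric]) auto
  show "mu h (C \<inter> jump_points f)
      = series_from_1 (\<lambda>n. unordered_sum (\<lambda>s. h s * indicator C s) (D n))"
    unfolding mu_def unordered_sum_mult_indicator
    by (rule unordered_sum_partition_seq[OF h partition_seq_Int[OF D]])
  show "mu h (C \<inter> jump_points f) = series_from_1 (\<lambda>n. ennreal (h (\<phi> n)))"
    if "bij_betw \<phi> {1..} (C \<inter> jump_points f)"
    unfolding mu_def by (rule unordered_sum_bij_betw[OF h that])
qed

theorem proposition3p13:
  fixes f :: "real \<Rightarrow> real" and D :: "nat \<Rightarrow> real set"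
    and \<Phi> :: "real \<Rightarrow> real" and B :: "real set"
  assumes "jump_points f \<noteq> {}"
    and "partition_seq D (jump_points f)"
    and "\<Phi> \<in> {0..} \<rightarrow> {0..}"
    and "strict_mono_on {0..} \<Phi>"
    and "continuous_on {0..} \<Phi>"
    and "\<Phi> 0 = 0"
    and "B \<noteq> {}"
    and "B \<subseteq> two_sided_limit_points f"
  shows
    "(unordered_sum (\<lambda>s. \<Phi> \<bar>jump f s\<bar>) B
        = mu (\<lambda>s. \<Phi> \<bar>jump f s\<bar>) (B \<inter> jump_points f)
      \<and> mu (\<lambda>s. \<Phi> \<bar>jump f s\<bar>) (B \<inter> jump_points f)
        = series_from_1 (\<lambda>n. unordered_sum (\<lambda>s. \<Phi> \<bar>jump f s\<bar> * indicator B s) (D n))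
      \<and> (\<forall>\<phi> :: nat \<Rightarrow> real. bij_betw \<phi> {1..} (B \<inter> jump_points f) \<longrightarrow>
          series_from_1 (\<lambda>n. unordered_sum (\<lambda>s. \<Phi> \<bar>jump f s\<bar> * indicator B s) (D n))
          = series_from_1 (\<lambda>n. ennreal (\<Phi> \<bar>jump f (\<phi> n)\<bar>))))
     \<and> (regulated f \<longrightarrow> (\<forall>t>0.
        unordered_sum (\<lambda>s. \<Phi> \<bar>jump f s\<bar>) {0<..t}
          = mu (\<lambda>s. \<Phi> \<bar>jump f s\<bar>) ({0<..t} \<inter> jump_points f)
        \<and> mu (\<lambda>s. \<Phi> \<bar>jump f s\<bar>) ({0<..t} \<inter> jump_points f)
          = series_from_1 (\<lambda>n. unordered_sum (\<lambda>s. \<Phi> \<bar>jump f s\<bar> * indicator {0<..t} s) (D n))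
        \<and> (\<forall>\<phi> :: nat \<Rightarrow> real. bij_betw \<phi> {1..} ({0<..t} \<inter> jump_points f) \<longrightarrow>
            series_from_1 (\<lambda>n. unordered_sum (\<lambda>s. \<Phi> \<bar>jump f s\<bar> * indicator {0<..t} s) (D n))
            = series_from_1 (\<lambda>n. ennreal (\<Phi> \<bar>jump f (\<phi> n)\<bar>)))))"
proof (intro conjI impI allI)
  note identities = jump_sum_identities[OF assms(2,3,6)]
  note B = identities[OF assms(8)]
  show "unordered_sum (\<lambda>s. \<Phi> \<bar>jump f s\<bar>) B = mu (\<lambda>s. \<Phi> \<bar>jump f s\<bar>) (B \<inter> jump_points f)"
    by (rule B(1))
  show "mu (\<lambda>s. \<Phi> \<bar>jump f s\<bar>) (B \<inter> jump_points f)
      = series_from_1 (\<lambda>n. unordered_sum (\<lambda>s. \<Phi> \<bar>jump f s\<bar> * indicator B s) (D n))"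
    by (rule B(2))
  show "series_from_1 (\<lambda>n. unordered_sum (\<lambda>s. \<Phi> \<bar>jump f s\<bar> * indicator B s) (D n))
      = series_from_1 (\<lambda>n. ennreal (\<Phi> \<bar>jump f (\<phi> n)\<bar>))"
    if "bij_betw \<phi> {1..} (B \<inter> jump_points f)" for \<phi> :: "nat \<Rightarrow> real"
    using B(2) B(3)[OF that] by (rule trans[OF sym])
  fix t :: real
  assume "regulated f" "0 < t"
  then have "{0<..t} \<subseteq> two_sided_limit_points f"
    by (auto simp: regulated_def two_sided_limit_points_def)
  note T = identities[OF this]
  show "unordered_sum (\<lambda>s. \<Phi> \<bar>jump f s\<bar>) {0<..t}
      = mu (\<lambda>s. \<Phi> \<bar>jump f s\<bar>) ({0<..t} \<inter> jump_points f)"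
    by (rule T(1))
  show "mu (\<lambda>s. \<Phi> \<bar>jump f s\<bar>) ({0<..t} \<inter> jump_points f)
      = series_from_1 (\<lambda>n. unordered_sum (\<lambda>s. \<Phi> \<bar>jump f s\<bar> * indicator {0<..t} s) (D n))"
    by (rule T(2))
  show "series_from_1 (\<lambda>n. unordered_sum (\<lambda>s. \<Phi> \<bar>jump f s\<bar> * indicator {0<..t} s) (D n))
      = series_from_1 (\<lambda>n. ennreal (\<Phi> \<bar>jump f (\<phi> n)\<bar>))"
    if "bij_betw \<phi> {1..} ({0<..t} \<inter> jump_points f)" for \<phi> :: "nat \<Rightarrow> real"
    using T(2) T(3)[OF that] by (rule trans[OF sym])
qed

end
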